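(* Let $W$ be a linear operator on $\mathcal H=L^2(\mathbb Z_J,\mu)$. For any $g',g''\in\mathcal H$ the operator $\widetilde W=\widehat g'W\widehat g''$ generates coefficients $\widetilde\omega_{m,n}=\omega_{m,n}(\widetilde W)$ such that for all $x,a\in\mathbb Z_J$ $$\sum_{m,n\in\mathbb Z_J}\widetilde\omega_{m,n}\eta^{mx}\eta^{na}=|g'(x)|^2\,\nu(x,a)\,|g''(a)|^2 .$$ The measure $d\mu_W(x,a)=\nu(x,a)\,d\mu(x)\,d\mu(a)$ on $\mathbb Z_J^2$ satisfies $$\|\widehat g'W\widehat g''\|_\mu^2=\int_{\mathbb Z_J^2}|g'(x)|^2|g''(a)|^2\,d\mu_W(x,a).$$
   Context: $\mathbb Z_J=\mathbb Z/J\mathbb Z$, each point has $\mu$-measure $1/J$, $\mathcal H=L^2(\mathbb Z_J,\mu)$ with $\langle f,g\rangle=\frac1J\sum_kf(k)\overline{g(k)}$, $\eta=e^{2\pi i/J}$. Every $f\in\mathcal H$ is written $f(x)=\sum_{j\in\mathbb Z_J}f_j\eta^{jx}$. A linear operator $W$ has matrix $(W_{k,j})$ with $(Wf)_k=\sum_jW_{k,j}f_j$. Define $$\omega_{m,n}=\omega_{m,n}(W)=\frac1J\sum_{j,l\in\mathbb Z_J}W_{l+m,j}\overline{W_{l,j+n}},\qquad\nu(x,a)=\sum_{m,n\in\mathbb Z_J}\omega_{m,n}\eta^{mx}\eta^{na}.$$ $\widehat g$ is the operator of (pointwise) multiplication by $g$. $\mu$-norm: $\|W\|_\mu^2=\inf_\chi\sum_{j}\mu(Y_j)\|W\pi_{Y_j}\|^2$,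 where the infimum is over partitions $\chi=\{Y_j\}$ of $\mathbb Z_J$, $\pi_Y$ is multiplication by the indicator $\mathbf 1_Y$, and $\|\cdot\|$ is the operator norm on $\mathcal H$. *)

theory Defs
  imports
    "HOL-Analysis.Analysis"
    "HOL-Library.Function_Algebras"
    "Berlekamp_Zassenhaus.Finite_Field"
begin

text \<open>
  The group \<open>\<int>/J\<int>\<close> is the type \<open>'n mod_ring\<close>, where \<open>J = CARD('n)\<close> is an arbitrary positive
  integer. Every point of it has positive mass, so that the elements of \<open>L\<^sup>2\<close> are simply all
  functions \<open>'n mod_ring \<Rightarrow> complex\<close>. The sum of two functions is the pointwise one of
  \<open>HOL-Library.Function_Algebras\<close>.
\<close>

type_synonym 'n func = "'n mod_ring \<Rightarrow> complex"
type_synonym 'n oper = "'n func \<Rightarrow> 'n func"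

definition fscale :: "complex \<Rightarrow> 'n::finite func \<Rightarrow> 'n func" where
  "fscale c f = (\<lambda>x. c * f x)"

definition linear_op :: "'n::finite oper \<Rightarrow> bool" where
  "linear_op W \<longleftrightarrow> Vector_Spaces.linear fscale fscale W"

definition mu :: "'n::finite mod_ring measure" where
  "mu = uniform_count_measure UNIV"

definition l2_inner :: "'n::finite func \<Rightarrow> 'n func \<Rightarrow> complex" where
  "l2_inner f g = (1 / of_nat CARD('n)) * (\<Sum>k\<in>UNIV. f k * cnj (g k))"

definition l2_norm :: "'n::finite func \<Rightarrow> real" where
  "l2_norm f = sqrt (Re (l2_inner f f))"

text \<open>Same form as \<^const>\<open>onorm\<close>; the function \<open>0\<close> contributes \<open>0 / 0 = 0\<close>.\<close>

definition op_norm :: "'n::finite oper \<Rightarrow> real" where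
  "op_norm A = (SUP f. l2_norm (A f) / l2_norm f)"

definition mult_op :: "'n::finite func \<Rightarrow> 'n oper" where
  "mult_op g = (\<lambda>f x. g x * f x)"

definition restr_op :: "'n::finite mod_ring set \<Rightarrow> 'n oper" where
  "restr_op Y = mult_op (indicator Y)"

definition mu_norm :: "'n::finite oper \<Rightarrow> real" where
  "mu_norm W = sqrt (INF P\<in>{P. partition_on UNIV P}.
     \<Sum>Y\<in>P. measure mu Y * (op_norm (W \<circ> restr_op Y))\<^sup>2)"

text \<open>
  \<open>eta_pow k\<close> is \<open>\<eta>\<^sup>k\<close> for \<open>\<eta> = exp (2\<pi>i/J)\<close>, computed with the representative of \<open>k\<close>
  in \<open>{0..<J}\<close>.
\<close>

definition eta_pow :: "'n::finite mod_ring \<Rightarrow> complex" where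
  "eta_pow k = exp (2 * of_real pi * \<i> / of_nat CARD('n)) powi to_int_mod_ring k"

definition fourier_coeff :: "'n::finite func \<Rightarrow> 'n mod_ring \<Rightarrow> complex" where
  "fourier_coeff f = (THE c. \<forall>x. f x = (\<Sum>j\<in>UNIV. c j * eta_pow (j * x)))"

text \<open>
  The matrix of \<open>W\<close> acts on Fourier coefficients, not on values. The two descriptions are
  justified by the lemmas \<open>fourier_coeff_unique\<close> and \<open>op_matrix_unique\<close> below.
\<close>

definition op_matrix :: "'n::finite oper \<Rightarrow> 'n mod_ring \<Rightarrow> 'n mod_ring \<Rightarrow> complex" where
  "op_matrix W = (THE M. \<forall>f k.
     fourier_coeff (W f) k = (\<Sum>j\<in>UNIV. M k j * fourier_coeff f j))"

definition omega :: "'n::finite oper \<Rightarrow> 'n mod_ring \<Rightarrow> 'n mod_ring \<Rightarrow> complex" where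
  "omega W m n = (1 / of_nat CARD('n)) *
     (\<Sum>j\<in>UNIV. \<Sum>l\<in>UNIV. op_matrix W (l + m) j * cnj (op_matrix W l (j + n)))"

definition nu :: "'n::finite oper \<Rightarrow> 'n mod_ring \<Rightarrow> 'n mod_ring \<Rightarrow> complex" where
  "nu W x a = (\<Sum>m\<in>UNIV. \<Sum>n\<in>UNIV. omega W m n * eta_pow (m * x) * eta_pow (n * a))"

text \<open>
  For linear \<open>W\<close> the function \<^term>\<open>nu W\<close> is real-valued and nonnegative; \<^const>\<open>Re\<close> and
  \<^const>\<open>ennreal\<close> only adjust the type of this density.
\<close>

definition mu_op :: "'n::finite oper \<Rightarrow> ('n mod_ring \<times> 'n mod_ring) measure" where
  "mu_op W = density (mu \<Otimes>\<^sub>M mu) (\<lambda>(x, a). ennreal (Re (nu W x a)))"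


lemma vector_space_fscale: "vector_space (fscale :: complex \<Rightarrow> 'n::finite func \<Rightarrow> 'n func)"
  by unfold_locales (auto simp: fscale_def fun_eq_iff algebra_simps)

lemma linear_op_iff:
  fixes W :: "'n::finite oper"
  shows "linear_op W \<longleftrightarrow> (\<forall>f g. W (f + g) = W f + W g) \<and> (\<forall>c f. W (fscale c f) = fscale c (W f))"
  using vector_space_fscale[where 'n='n]
  unfolding linear_op_def Vector_Spaces.linear_def module_hom_def module_hom_axioms_def
    vector_space_def Modules.module_def by blast

lemma measure_mu: "measure mu Y = card Y / CARD('n)" for Y :: "'n::finite mod_ring set"
  by (simp add: mu_def measure_uniform_count_measure)

lemma eta_powi_mod:
  "exp (2 * of_real pi * \<i> / of_nat CARD('n::finite)) powi (k mod int CARD('n)) =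
   exp (2 * of_real pi * \<i> / of_nat CARD('n)) powi k"
proof -
  let ?e = "exp (2 * of_real pi * \<i> / of_nat CARD('n)) :: complex"
  have "?e ^ CARD('n) = exp (of_nat CARD('n) * (2 * of_real pi * \<i> / of_nat CARD('n)))"
    by (simp only: exp_of_nat_mult)
  also have "\<dots> = 1" by (simp add: exp_two_pi_i)
  finally have 1: "?e ^ CARD('n) = 1" .
  have "?e powi k = ?e powi (int CARD('n) * (k div int CARD('n)) + k mod int CARD('n))"
    by simp
  also have "\<dots> = ?e powi (k mod int CARD('n))"
    by (subst power_int_add) (simp_all add: power_int_mult 1 del: mult_div_mod_eq)
  finally show ?thesis ..
qed

lemma eta_pow_add: "eta_pow (a + b) = eta_pow a * eta_pow b"
proof -
  have "to_int_mod_ring (a + b) = (to_int_mod_ring a + to_int_mod_ring b) mod int CARD('a)"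
    by transfer simp
  thus ?thesis by (simp add: eta_pow_def eta_powi_mod power_int_add)
qed

lemma eta_pow_0 [simp]: "eta_pow 0 = 1"
proof -
  have "to_int_mod_ring (0::'a::finite mod_ring) = 0" by transfer simp
  thus ?thesis by (simp add: eta_pow_def)
qed

lemma eta_pow_neq_1:
  fixes k :: "'n::finite mod_ring"
  assumes "k \<noteq> 0"
  shows "eta_pow k \<noteq> 1"
proof
  assume "eta_pow k = 1"
  define r where "r = to_int_mod_ring k"
  have r: "0 < r" "r < int CARD('n)"
    unfolding r_def using assms by (transfer, force)+
  have "eta_pow k = exp (of_nat (nat r) * (2 * of_real pi * \<i> / of_nat CARD('n)))"
    using r by (simp only: exp_of_nat_mult) (simp add: eta_pow_def r_def power_int_def)
  also have "\<dots> = exp (2 * of_real pi * \<i> * of_nat (nat r) / of_nat CARD('n))"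
    by (simp add: mult_ac)
  finally have "CARD('n) dvd nat r"
    using \<open>eta_pow k = 1\<close> complex_root_unity_eq_1[of "CARD('n)" "nat r"] by simp
  thus False using r by (auto dest: dvd_imp_le)
qed

lemma eta_pow_sum:
  fixes j :: "'n::finite mod_ring"
  shows "(\<Sum>x\<in>UNIV. eta_pow (j * x)) = (if j = 0 then of_nat CARD('n) else 0)"
proof (cases "j = 0")
  case False
  define u :: "'n mod_ring" where "u = of_int_mod_ring 1"
  have u: "j * u = j" unfolding u_def by transfer (simp add: mod_mult_right_eq)
  have "(\<Sum>x\<in>UNIV. eta_pow (j * x)) = (\<Sum>x\<in>UNIV. eta_pow (j * (x + u)))"
    by (rule sum.reindex_bij_witness[of _ "\<lambda>x. x + u" "\<lambda>x. x - u"]) auto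
  also have "\<dots> = (\<Sum>x\<in>UNIV. eta_pow (j * x)) * eta_pow j"
    by (simp add: distrib_left eta_pow_add u sum_distrib_right)
  finally show ?thesis using False eta_pow_neq_1[OF False] by simp
qed simp

lemma fourier_coeff_explicit:
  fixes f :: "'n::finite func"
  shows "(\<forall>x. f x = (\<Sum>j\<in>UNIV. c j * eta_pow (j * x))) \<longleftrightarrow>
    c = (\<lambda>j. (1 / of_nat CARD('n)) * (\<Sum>x\<in>UNIV. f x * eta_pow (- j * x)))"
    (is "?L \<longleftrightarrow> ?R")
proof
  assume L: ?L
  show ?R
  proof
    fix j
    have "(\<Sum>x\<in>UNIV. f x * eta_pow (- j * x)) =
      (\<Sum>x\<in>UNIV. \<Sum>i\<in>UNIV. c i * eta_pow ((i - j) * x))"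
      using L by (simp add: sum_distrib_right mult.assoc flip: eta_pow_add)
        (simp add: algebra_simps)
    also have "\<dots> = (\<Sum>i\<in>UNIV. c i * (\<Sum>x\<in>UNIV. eta_pow ((i - j) * x)))"
      by (subst sum.swap) (simp add: sum_distrib_left)
    also have "\<dots> = (\<Sum>i\<in>UNIV. if i = j then c i * of_nat CARD('n) else 0)"
      by (intro sum.cong) (auto simp: eta_pow_sum)
    also have "\<dots> = c j * of_nat CARD('n)" by simp
    finally show "c j = (1 / of_nat CARD('n)) * (\<Sum>x\<in>UNIV. f x * eta_pow (- j * x))" by simp
  qed
next
  assume R: ?R
  show ?L
  proof
    fix x
    have "(\<Sum>j\<in>UNIV. c j * eta_pow (j * x)) =
      (1 / of_nat CARD('n)) * (\<Sum>j\<in>UNIV. \<Sum>y\<in>UNIV. f y * eta_pow ((x - y) * j))"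
      unfolding R by (simp add: sum_distrib_right sum_distrib_left sum_divide_distrib
          mult.assoc flip: eta_pow_add) (simp add: algebra_simps)
    also have "\<dots> = (1 / of_nat CARD('n)) *
        (\<Sum>y\<in>UNIV. f y * (\<Sum>j\<in>UNIV. eta_pow ((x - y) * j)))"
      by (subst sum.swap) (simp add: sum_distrib_left)
    also have "(\<Sum>y\<in>UNIV. f y * (\<Sum>j\<in>UNIV. eta_pow ((x - y) * j))) =
        (\<Sum>y\<in>UNIV. if y = x then f y * of_nat CARD('n) else 0)"
      by (intro sum.cong) (auto simp: eta_pow_sum)
    finally show "f x = (\<Sum>j\<in>UNIV. c j * eta_pow (j * x))" by simp
  qed
qed

lemma fourier_coeff_unique:
  "\<exists>!c. \<forall>x. f x = (\<Sum>j\<in>UNIV. c j * eta_pow (j * x))"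
  by (simp only: fourier_coeff_explicit) simp

lemma fourier_expansion: "f x = (\<Sum>j\<in>UNIV. fourier_coeff f j * eta_pow (j * x))"
  using theI'[OF fourier_coeff_unique[of f]] unfolding fourier_coeff_def by blast

lemma fourier_coeff_eqI:
  "(\<And>x. f x = (\<Sum>j\<in>UNIV. c j * eta_pow (j * x))) \<Longrightarrow> fourier_coeff f = c"
  using fourier_coeff_unique[of f] fourier_expansion[of f] by blast

lemma fourier_coeff_eta: "fourier_coeff (\<lambda>x. eta_pow (i * x)) j = (if j = i then 1 else 0)"
proof -
  have "fourier_coeff (\<lambda>x. eta_pow (i * x)) = (\<lambda>j. if j = i then 1 else 0)"
    by (rule fourier_coeff_eqI) (simp add: if_distrib[of "\<lambda>c. c * _"] cong: if_cong)
  thus ?thesis by simp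
qed

lemma op_matrix_unique:
  fixes W :: "'n::finite oper"
  assumes "linear_op W"
  shows "\<exists>!M. \<forall>f k. fourier_coeff (W f) k = (\<Sum>j\<in>UNIV. M k j * fourier_coeff f j)"
proof (rule ex1I)
  let ?e = "\<lambda>i x. eta_pow (i * x)" and ?M = "\<lambda>k j. fourier_coeff (W (\<lambda>x. eta_pow (j * x))) k"
  interpret Vector_Spaces.linear fscale fscale W
    using assms by (simp add: linear_op_def)
  have sum_app: "sum F A x = (\<Sum>i\<in>A. F i x)" if "finite A"
    for F :: "'n mod_ring \<Rightarrow> 'n func" and A x
    using that by (induction) auto
  show "\<forall>f k. fourier_coeff (W f) k = (\<Sum>j\<in>UNIV. ?M k j * fourier_coeff f j)"
  proof (intro allI)
    fix f :: "'n func" and k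
    have f: "f = (\<Sum>j\<in>UNIV. fscale (fourier_coeff f j) (?e j))"
    proof
      fix x
      show "f x = (\<Sum>j\<in>UNIV. fscale (fourier_coeff f j) (?e j)) x"
        by (subst fourier_expansion[of f x]) (simp add: sum_app fscale_def)
    qed
    have "W f = (\<Sum>j\<in>UNIV. fscale (fourier_coeff f j) (W (?e j)))"
      by (subst f) (simp add: sum scale)
    hence "W f x = (\<Sum>j\<in>UNIV. fourier_coeff f j * (\<Sum>i\<in>UNIV. ?M i j * eta_pow (i * x)))" for x
      by (simp add: sum_app fscale_def flip: fourier_expansion)
    hence "W f x = (\<Sum>i\<in>UNIV. (\<Sum>j\<in>UNIV. ?M i j * fourier_coeff f j) * eta_pow (i * x))" for x
      by (simp add: sum_distrib_left sum_distrib_right mult_ac) (subst sum.swap, simp)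
    from fourier_coeff_eqI[OF this]
    show "fourier_coeff (W f) k = (\<Sum>j\<in>UNIV. ?M k j * fourier_coeff f j)" by simp
  qed
  fix M assume M: "\<forall>f k. fourier_coeff (W f) k = (\<Sum>j\<in>UNIV. M k j * fourier_coeff f j)"
  show "M = ?M"
    by (intro ext) (simp add: M fourier_coeff_eta if_distrib[of "\<lambda>c. _ * c"] cong: if_cong)
qed

end

theory Submission
  imports Defs
begin

text \<open>
  Besides its matrix in the Fourier basis, \<open>W\<close> has a kernel on points,
  \<open>(W f)(x) = \<Sum>\<^sub>a K(x, a) f(a)\<close>, and both halves of the statement become transparent in terms
  of \<open>K\<close>.

  The Fourier series of the correlation coefficients \<open>\<omega>\<^sub>m\<^sub>,\<^sub>n\<close> factors: with \<open>p = l + m\<close> and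
  \<open>q = j + n\<close> the phase \<open>\<eta>\<close> to the power \<open>m x + n a\<close> splits into a part in \<open>(p, j)\<close> and the
  conjugate of the same part in \<open>(l, q)\<close>, so that \<open>J\<close> times the sum is a number times its own conjugate.
  That number is the double Fourier series of the matrix, which is \<open>J K(x, a)\<close>
  (\<open>op_kernel_op_matrix\<close>). Hence \<open>\<nu>(x, a) = J |K(x, a)|\<^sup>2\<close> (\<open>nu_eq_kernel\<close>), which is real and
  nonnegative. Multiplication operators on both sides replace \<open>K(x, a)\<close> by
  \<open>g'(x) K(x, a) g''(a)\<close>, and the transformation law of \<open>\<nu>\<close> follows.

  The infimum in the \<open>\<mu>\<close>-norm is attained at the partition into points. For the
  restriction \<open>\<pi>\<^sub>a\<close> to a single point,
  \<open>W \<pi>\<^sub>a\<close> has rank at most one and squared norm \<open>\<Sum>\<^sub>x |K(x, a)|\<^sup>2\<close>. For a larger cell \<open>Y\<close>, the norm of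
  \<open>W \<pi>\<^sub>Y\<close> is at least that of each \<open>W \<pi>\<^sub>a\<close> with \<open>a \<in> Y\<close>, so \<open>\<mu>(Y)\<close> times its square
  dominates what the points of \<open>Y\<close> contribute separately. Therefore the squared \<open>\<mu>\<close>-norm is
  \<open>J\<^sup>-\<^sup>1 \<Sum>\<^sub>x\<^sub>,\<^sub>a |K(x, a)|\<^sup>2\<close> (\<open>mu_norm_eq\<close>). Integrating the density \<open>\<nu> = J |K|\<^sup>2\<close> against the
  product measure, which gives each pair mass \<open>J\<^sup>-\<^sup>2\<close>, yields the same value.
\<close>

section \<open>The kernel of an operator and its density\<close>

definition op_kernel :: "'n::finite oper \<Rightarrow> 'n mod_ring \<Rightarrow> 'n mod_ring \<Rightarrow> complex" where
  "op_kernel W x a = W (indicator {a}) x"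

lemma linear_op_eq_kernel:
  fixes W :: "'n::finite oper"
  assumes "linear_op W"
  shows "W f x = (\<Sum>a\<in>UNIV. op_kernel W x a * f a)"
proof -
  interpret Vector_Spaces.linear fscale fscale W
    using assms by (simp add: linear_op_def)
  have sum_app: "sum F A y = (\<Sum>a\<in>A. F a y)" if "finite A"
    for F :: "'n mod_ring \<Rightarrow> 'n func" and A y
    using that by induction auto
  have "f = (\<Sum>a\<in>UNIV. fscale (f a) (indicator {a}))"
    by (rule ext) (simp add: sum_app fscale_def indicator_def if_distrib[of "\<lambda>c. _ * c"] cong: if_cong)
  hence "W f = (\<Sum>a\<in>UNIV. fscale (f a) (W (indicator {a})))"
    by (metis (no_types, lifting) sum scale sum.cong)
  thus ?thesis by (simp add: sum_app fscale_def op_kernel_def mult_ac)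
qed

lemma cnj_eta_pow: "cnj (eta_pow k) = eta_pow (- k)"
proof -
  have "cmod (eta_pow k) = 1"
    by (simp add: eta_pow_def norm_power_int norm_exp_eq_Re)
  hence "cnj (eta_pow k) * eta_pow k = 1"
    by (simp add: mult.commute complex_norm_square[symmetric])
  moreover have "eta_pow (- k) * eta_pow k = 1"
    by (simp flip: eta_pow_add)
  ultimately show ?thesis
    by (metis mult_right_cancel mult_zero_right zero_neq_one)
qed

lemma fourier_coeff_indicator:
  fixes a :: "'n::finite mod_ring"
  shows "fourier_coeff (indicator {a}) j = eta_pow (- j * a) / of_nat CARD('n)"
proof -
  have "fourier_coeff (indicator {a} :: 'n func) =
    (\<lambda>j. (1 / of_nat CARD('n)) * (\<Sum>x\<in>UNIV. indicator {a} x * eta_pow (- j * x)))"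
    by (rule iffD1[OF fourier_coeff_explicit]) (use fourier_expansion in blast)
  thus ?thesis by (simp add: indicator_def if_distrib[of "\<lambda>c. c * _"] cong: if_cong)
qed

text \<open>
  The matrix acts on Fourier coefficients and the point mass at \<open>a\<close> has coefficients
  \<open>J\<^sup>-\<^sup>1 \<eta>\<^sup>-\<^sup>j\<^sup>a\<close>; evaluating the Fourier series of its image at \<open>x\<close> gives the kernel.
\<close>

lemma op_kernel_op_matrix:
  fixes W :: "'n::finite oper"
  assumes "linear_op W"
  shows "of_nat CARD('n) * op_kernel W x a
    = (\<Sum>k\<in>UNIV. \<Sum>j\<in>UNIV. op_matrix W k j * eta_pow (k * x - j * a))"
proof -
  have M: "fourier_coeff (W f) k = (\<Sum>j\<in>UNIV. op_matrix W k j * fourier_coeff f j)" for f k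
    using theI'[OF op_matrix_unique[OF assms]] unfolding op_matrix_def by blast
  have "op_kernel W x a = (\<Sum>k\<in>UNIV. fourier_coeff (W (indicator {a})) k * eta_pow (k * x))"
    unfolding op_kernel_def by (rule fourier_expansion)
  also have "\<dots> = (\<Sum>k\<in>UNIV. \<Sum>j\<in>UNIV.
      op_matrix W k j * eta_pow (k * x - j * a) / of_nat CARD('n))"
    by (simp add: M fourier_coeff_indicator sum_distrib_left diff_conv_add_uminus
        eta_pow_add mult_ac del: add_uminus_conv_diff)
  finally show ?thesis by (simp flip: sum_divide_distrib)
qed

text \<open>
  A two-dimensional Wiener-Khinchin identity: up to normalization, the Fourier transform of the autocorrelation of
  the matrix is the squared modulus of the Fourier transform of the matrix.
\<close>

lemma nu_eq_kernel:
  fixes W :: "'n::finite oper"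
  assumes "linear_op W"
  shows "nu W x a = of_real (CARD('n) * (cmod (op_kernel W x a))\<^sup>2)"
proof -
  let ?J = "of_nat CARD('n) :: complex"
  let ?t = "\<lambda>k j. op_matrix W k j * eta_pow (k * x - j * a)"
  \<comment> \<open>The terms in \<open>l x\<close> and \<open>j a\<close> cancel, so that the phase splits along the two matrix entries.\<close>
  have eta: "eta_pow (m * x) * eta_pow (n * a)
      = eta_pow ((l + m) * x - j * a) * cnj (eta_pow (l * x - (j + n) * a))" for m n j l
    by (simp add: cnj_eta_pow algebra_simps flip: eta_pow_add)
  have "op_matrix W (l + m) j * cnj (op_matrix W l (j + n)) * eta_pow (m * x) * eta_pow (n * a)
      = ?t (l + m) j * cnj (?t l (j + n))" for m n j l
    by (simp only: mult.assoc eta[of m n l j] complex_cnj_mult) (simp only: mult_ac)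
  hence "nu W x a = (\<Sum>m\<in>UNIV. \<Sum>n\<in>UNIV. \<Sum>j\<in>UNIV. \<Sum>l\<in>UNIV.
      ?t (l + m) j * cnj (?t l (j + n))) / ?J"
    by (simp only: nu_def omega_def sum_distrib_right sum_distrib_left sum_divide_distrib
        times_divide_eq_left mult_1)
  also have "(\<Sum>m\<in>UNIV. \<Sum>n\<in>UNIV. \<Sum>j\<in>UNIV. \<Sum>l\<in>UNIV. ?t (l + m) j * cnj (?t l (j + n)))
      = (\<Sum>(m, n, j, l)\<in>UNIV. ?t (l + m) j * cnj (?t l (j + n)))"
    by (simp add: sum.cartesian_product)
  also have "\<dots> = (\<Sum>(p, j, l, q)\<in>UNIV. ?t p j * cnj (?t l q))"
    by (rule sum.reindex_bij_witness[of _ "\<lambda>(p, j, l, q). (p - l, q - j, j, l)"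
          "\<lambda>(m, n, j, l). (l + m, j, l, j + n)"]) auto
  also have "\<dots> = (\<Sum>p\<in>UNIV. \<Sum>j\<in>UNIV. \<Sum>l\<in>UNIV. \<Sum>q\<in>UNIV. ?t p j * cnj (?t l q))"
    by (simp add: sum.cartesian_product)
  also have "\<dots> = (\<Sum>p\<in>UNIV. \<Sum>j\<in>UNIV. ?t p j * cnj (\<Sum>l\<in>UNIV. \<Sum>q\<in>UNIV. ?t l q))"
    by (simp only: cnj_sum sum_distrib_left)
  also have "\<dots> = (\<Sum>p\<in>UNIV. \<Sum>j\<in>UNIV. ?t p j) * cnj (\<Sum>l\<in>UNIV. \<Sum>q\<in>UNIV. ?t l q)"
    by (simp only: sum_distrib_right)
  also have "\<dots> = (?J * op_kernel W x a) * cnj (?J * op_kernel W x a)"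
    by (simp only: op_kernel_op_matrix[OF assms])
  finally show ?thesis by (simp add: complex_norm_square[symmetric] mult_ac)
qed

lemma op_kernel_mult_op:
  fixes W :: "'n::finite oper"
  assumes "linear_op W"
  shows "op_kernel (mult_op g \<circ> W \<circ> mult_op h) x a = g x * op_kernel W x a * h a"
  by (simp add: op_kernel_def[of "_ \<circ> _"] mult_op_def linear_op_eq_kernel[OF assms] indicator_def
      of_bool_def if_distrib[of "\<lambda>c. _ * c"] cong: if_cong)

lemma linear_op_mult_op:
  assumes "linear_op W"
  shows "linear_op (mult_op g \<circ> W \<circ> mult_op h)"
proof -
  have "mult_op k (f + f') = mult_op k f + mult_op k f'"
    and "mult_op k (fscale c f) = fscale c (mult_op k f)" for k f f' :: "'a func" and c
    by (auto simp: mult_op_def fscale_def algebra_simps)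
  thus ?thesis using assms by (simp add: linear_op_iff)
qed

section \<open>The \<open>\<mu>\<close>-norm as a normalized Hilbert-Schmidt norm\<close>

lemma l2_norm_eq:
  fixes f :: "'n::finite func"
  shows "l2_norm f = sqrt ((\<Sum>x\<in>UNIV. (cmod (f x))\<^sup>2) / CARD('n))"
  by (simp add: l2_norm_def l2_inner_def Re_divide_of_nat complex_norm_square[symmetric] flip: of_real_power)

lemma norm_le_l2_norm:
  fixes f :: "'n::finite func"
  shows "cmod (f a) \<le> sqrt (CARD('n)) * l2_norm f"
proof -
  have "(cmod (f a))\<^sup>2 \<le> (\<Sum>x\<in>UNIV. (cmod (f x))\<^sup>2)"
    by (rule member_le_sum) auto
  thus ?thesis by (simp add: l2_norm_eq real_sqrt_divide real_le_rsqrt)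
qed

text \<open>
  A supremum of reals bounds its family only if the family is bounded. For that purpose the
  crude bound by a multiple of the sum of all \<open>|K(x, a)|\<close> suffices.
\<close>

lemma bdd_above_op_norm:
  fixes W :: "'n::finite oper"
  assumes "linear_op W"
  shows "bdd_above (range (\<lambda>f. l2_norm (W f) / l2_norm f))"
proof (rule bdd_aboveI2)
  fix f :: "'n func"
  let ?B = "\<Sum>a\<in>UNIV. \<Sum>x\<in>UNIV. cmod (op_kernel W x a) * sqrt (CARD('n))"
  have "cmod (W f x) \<le> ?B * l2_norm f" for x
  proof -
    have "cmod (W f x) \<le> (\<Sum>a\<in>UNIV. cmod (op_kernel W x a) * cmod (f a))"
      unfolding linear_op_eq_kernel[OF assms, of f x] by (rule sum_norm_le) (simp add: norm_mult)
    also have "\<dots> \<le> (\<Sum>a\<in>UNIV. cmod (op_kernel W x a) * (sqrt (CARD('n)) * l2_norm f))"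
      by (intro sum_mono mult_left_mono norm_le_l2_norm) auto
    also have "\<dots> \<le> (\<Sum>a\<in>UNIV. \<Sum>y\<in>UNIV. cmod (op_kernel W y a) * (sqrt (CARD('n)) * l2_norm f))"
      by (intro sum_mono member_le_sum) (auto simp: l2_norm_eq sum_nonneg)
    finally show ?thesis by (simp add: sum_distrib_right mult.assoc)
  qed
  hence "(\<Sum>x\<in>UNIV. (cmod (W f x))\<^sup>2) \<le> (\<Sum>x\<in>(UNIV :: 'n mod_ring set). (?B * l2_norm f)\<^sup>2)"
    by (intro sum_mono power_mono) auto
  hence "(\<Sum>x\<in>UNIV. (cmod (W f x))\<^sup>2) / CARD('n) \<le> (?B * l2_norm f)\<^sup>2"
    by (simp add: divide_simps mult.commute)
  moreover have "0 \<le> ?B * l2_norm f" by (simp add: l2_norm_eq sum_nonneg)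
  ultimately have "l2_norm (W f) \<le> ?B * l2_norm f"
    unfolding l2_norm_eq[of "W f"] by (rule real_le_lsqrt[rotated])
  moreover have "0 \<le> l2_norm f" "0 \<le> ?B" by (auto simp: l2_norm_eq sum_nonneg)
  ultimately show "l2_norm (W f) / l2_norm f \<le> ?B" by (cases "l2_norm f = 0") (auto simp: field_simps)
qed

definition column_mass :: "'n::finite oper \<Rightarrow> 'n mod_ring \<Rightarrow> real" where
  "column_mass W a = (\<Sum>x\<in>UNIV. (cmod (op_kernel W x a))\<^sup>2)"

lemma column_mass_nonneg: "0 \<le> column_mass W a"
  by (simp add: column_mass_def sum_nonneg)

lemma linear_op_restr: "linear_op W \<Longrightarrow> linear_op (W \<circ> restr_op Y)"
  using linear_op_mult_op[of W "\<lambda>_. 1" "indicator Y"]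
  by (simp add: restr_op_def mult_op_def[of "\<lambda>_. 1"] comp_def)

text \<open>The point mass at \<open>a\<close> is a test function for \<open>W \<pi>\<^sub>Y\<close> whenever \<open>a \<in> Y\<close>.\<close>

lemma column_mass_le_op_norm:
  fixes W :: "'n::finite oper"
  assumes "linear_op W" "a \<in> Y"
  shows "column_mass W a \<le> (op_norm (W \<circ> restr_op Y))\<^sup>2"
proof -
  have "(cmod (indicator {a} x))\<^sup>2 = (if x = a then 1 else 0)" for x
    by simp
  hence "l2_norm (indicator {a} :: 'n func) = sqrt (1 / CARD('n))"
    by (simp add: l2_norm_eq del: indicator_simps)
  moreover have "restr_op Y (indicator {a}) = indicator {a}"
    using \<open>a \<in> Y\<close> by (auto simp: restr_op_def mult_op_def indicator_def)
  moreover have "l2_norm (W (indicator {a})) = sqrt (column_mass W a / CARD('n))"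
    by (simp add: l2_norm_eq column_mass_def op_kernel_def)
  ultimately have "sqrt (column_mass W a)
      = l2_norm ((W \<circ> restr_op Y) (indicator {a})) / l2_norm (indicator {a} :: 'n func)"
    by (simp add: real_sqrt_divide)
  also have "\<dots> \<le> op_norm (W \<circ> restr_op Y)"
    unfolding op_norm_def
    by (rule cSUP_upper[OF UNIV_I bdd_above_op_norm]) (rule linear_op_restr[OF assms(1)])
  finally show ?thesis by (rule sqrt_le_D)
qed

text \<open>
  Restricted to one point, \<open>W\<close> has rank at most one: \<open>f\<close> is sent to \<open>f(a)\<close> times the column of the
  kernel at \<open>a\<close>, and \<open>|f(a)|\<close> is at most \<open>\<surd>J\<close> times the norm of \<open>f\<close>.
\<close>

lemma op_norm_singleton:
  fixes W :: "'n::finite oper"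
  assumes "linear_op W"
  shows "(op_norm (W \<circ> restr_op {a}))\<^sup>2 = column_mass W a"
proof (rule antisym)
  have "l2_norm ((W \<circ> restr_op {a}) f) / l2_norm f \<le> sqrt (column_mass W a)" for f
  proof -
    have "(W \<circ> restr_op {a}) f = (\<lambda>x. op_kernel W x a * f a)"
      by (rule ext) (simp add: linear_op_eq_kernel[OF assms] restr_op_def mult_op_def indicator_def
          of_bool_def if_distrib[of "\<lambda>c. _ * c"] if_distrib[of "\<lambda>c. c * _"] cong: if_cong)
    hence "l2_norm ((W \<circ> restr_op {a}) f) = sqrt (column_mass W a) * cmod (f a) / sqrt (CARD('n))"
      by (simp add: l2_norm_eq column_mass_def norm_mult power_mult_distrib
          real_sqrt_divide real_sqrt_mult flip: sum_distrib_right)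
    also have "\<dots> \<le> sqrt (column_mass W a) * l2_norm f"
      using mult_left_mono[OF norm_le_l2_norm[of f a], of "sqrt (column_mass W a)"]
      by (simp add: divide_simps column_mass_nonneg mult_ac)
    finally have "l2_norm ((W \<circ> restr_op {a}) f) \<le> sqrt (column_mass W a) * l2_norm f" .
    moreover have "0 \<le> l2_norm f" by (simp add: l2_norm_eq sum_nonneg)
    ultimately show ?thesis
      by (cases "l2_norm f = 0") (auto simp: field_simps column_mass_nonneg)
  qed
  hence "op_norm (W \<circ> restr_op {a}) \<le> sqrt (column_mass W a)"
    unfolding op_norm_def by (intro cSUP_least) auto
  \<comment> \<open>Squaring the bound needs the sign of the supremum; any single quotient provides it.\<close>
  moreover have "0 \<le> l2_norm ((W \<circ> restr_op {a}) 0) / l2_norm 0"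
    by (simp add: l2_norm_eq sum_nonneg)
  hence "0 \<le> op_norm (W \<circ> restr_op {a})"
    unfolding op_norm_def
    by (rule order_trans[OF _ cSUP_upper[OF UNIV_I bdd_above_op_norm]])
      (rule linear_op_restr[OF assms])
  ultimately show "(op_norm (W \<circ> restr_op {a}))\<^sup>2 \<le> column_mass W a"
    using column_mass_nonneg[of W a] by (metis power_mono real_sqrt_pow2)
qed (simp add: column_mass_le_op_norm assms)

text \<open>
  Merging points into a cell \<open>Y\<close> replaces the sum of the column masses over \<open>Y\<close> by at least
  \<open>card Y\<close> times their maximum, so that the partition into points is optimal.
\<close>

lemma mu_norm_eq:
  fixes W :: "'n::finite oper"
  assumes "linear_op W"
  shows "(mu_norm W)\<^sup>2 = (\<Sum>a\<in>UNIV. column_mass W a) / CARD('n)"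
proof -
  let ?F = "\<lambda>P. \<Sum>Y\<in>P. measure mu Y * (op_norm (W \<circ> restr_op Y))\<^sup>2"
  let ?S = "\<Sum>a\<in>UNIV. column_mass W a / CARD('n)"
  have lower: "?S \<le> ?F P" if "partition_on UNIV P" for P
  proof -
    have "?S = (\<Sum>Y\<in>P. \<Sum>a\<in>Y. column_mass W a / CARD('n))"
      using sum.Union_disjoint_sets[of P "\<lambda>a. column_mass W a / CARD('n)"] that
      by (simp add: partition_on_def)
    also have "\<dots> \<le> ?F P"
    proof (rule sum_mono)
      fix Y
      have "(\<Sum>a\<in>Y. column_mass W a / CARD('n))
          \<le> (\<Sum>a\<in>Y. (op_norm (W \<circ> restr_op Y))\<^sup>2 / CARD('n))"
        by (intro sum_mono divide_right_mono column_mass_le_op_norm assms) auto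
      thus "(\<Sum>a\<in>Y. column_mass W a / CARD('n)) \<le> measure mu Y * (op_norm (W \<circ> restr_op Y))\<^sup>2"
        by (simp add: measure_mu)
    qed
    finally show ?thesis .
  qed
  define Q where "Q = range (\<lambda>a :: 'n mod_ring. {a})"
  have "partition_on UNIV Q"
    by (auto simp: Q_def partition_on_def disjoint_def)
  moreover have "?F Q = ?S"
    by (simp add: Q_def sum.reindex op_norm_singleton[OF assms] measure_mu)
  ultimately have "(INF P\<in>{P. partition_on UNIV P}. ?F P) = ?S"
    by (intro cInf_eq_minimum) (use lower in force)+
  thus ?thesis
    by (simp add: mu_norm_def sum_nonneg column_mass_nonneg flip: sum_divide_distrib)
qed

section \<open>The measure with density \<open>\<nu>\<close>\<close>

lemma pair_mu_eq_point_measure: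
  "(mu :: 'n::finite mod_ring measure) \<Otimes>\<^sub>M (mu :: 'n mod_ring measure)
    = point_measure UNIV (\<lambda>_. ennreal (1 / (CARD('n))\<^sup>2))"
proof (rule measure_eqI_finite[of _ UNIV])
  interpret finite_measure "mu :: 'n mod_ring measure"
    by (rule finite_measureI) (simp add: mu_def space_uniform_count_measure emeasure_uniform_count_measure)
  have sets: "sets (mu :: 'n mod_ring measure) = sets (count_space UNIV)"
    by (simp add: mu_def sets_uniform_count_measure)
  show "sets ((mu :: 'n mod_ring measure) \<Otimes>\<^sub>M (mu :: 'n mod_ring measure)) = Pow UNIV"
    by (subst sets_pair_countable[of UNIV UNIV]) (simp_all add: countable_finite sets)
  have emeasure: "emeasure (mu :: 'n mod_ring measure) {x} = ennreal (1 / CARD('n))" for x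
    by (simp add: mu_def emeasure_uniform_count_measure)
  fix z :: "'n mod_ring \<times> 'n mod_ring"
  have "emeasure (mu \<Otimes>\<^sub>M mu) ({fst z} \<times> {snd z}) = ennreal (1 / CARD('n)) * ennreal (1 / CARD('n))"
    by (subst emeasure_pair_measure_Times) (simp_all add: sets emeasure)
  also have "\<dots> = ennreal (1 / (CARD('n))\<^sup>2)"
    by (simp add: power2_eq_square flip: ennreal_mult)
  also have "{fst z} \<times> {snd z} = {z}" by auto
  finally show "emeasure (mu \<Otimes>\<^sub>M mu) {z}
      = emeasure (point_measure UNIV (\<lambda>_. ennreal (1 / (CARD('n))\<^sup>2))) {z}"
    by (simp add: emeasure_point_measure_finite)
qed (auto simp: sets_point_measure)

lemma integral_mu_op:
  fixes W :: "'n::finite oper" and f :: "'n mod_ring \<times> 'n mod_ring \<Rightarrow> real"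
  assumes "\<And>x a. 0 \<le> Re (nu W x a)"
  shows "integral\<^sup>L (mu_op W) f
    = (\<Sum>x\<in>UNIV. \<Sum>a\<in>UNIV. Re (nu W x a) * f (x, a)) / (CARD('n))\<^sup>2"
proof -
  have "integral\<^sup>L (mu_op W) f
      = (\<integral>(x, a). Re (nu W x a) * f (x, a) \<partial>point_measure UNIV (\<lambda>_. ennreal (1 / (CARD('n))\<^sup>2)))"
    unfolding mu_op_def pair_mu_eq_point_measure
    using integral_density[of f "point_measure UNIV (\<lambda>_. ennreal (1 / (CARD('n))\<^sup>2))"
        "\<lambda>(x, a). Re (nu W x a)"] assms
    by (simp add: case_prod_unfold)
  also have "\<dots> = (\<Sum>z\<in>UNIV. (1 / (CARD('n))\<^sup>2) * (case z of (x, a) \<Rightarrow> Re (nu W x a) * f (x, a)))"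
    by (subst lebesgue_integral_point_measure_finite) auto
  finally show ?thesis
    by (simp add: sum.cartesian_product sum_divide_distrib case_prod_unfold)
qed

theorem lemma6p4:
  fixes W :: "('n::finite mod_ring \<Rightarrow> complex) \<Rightarrow> ('n mod_ring \<Rightarrow> complex)"
    and g' g'' :: "'n mod_ring \<Rightarrow> complex"
  assumes "linear_op W"
  shows "(\<forall>x a.
            (\<Sum>m\<in>UNIV. \<Sum>n\<in>UNIV.
               omega (mult_op g' \<circ> W \<circ> mult_op g'') m n * eta_pow (m * x) * eta_pow (n * a))
            = of_real ((cmod (g' x))\<^sup>2) * nu W x a * of_real ((cmod (g'' a))\<^sup>2))
       \<and> (\<forall>x a. nu W x a \<in> \<real> \<and> 0 \<le> Re (nu W x a))
       \<and> (mu_norm (mult_op g' \<circ> W \<circ> mult_op g''))\<^sup>2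
            = (\<integral>(x, a). (cmod (g' x))\<^sup>2 * (cmod (g'' a))\<^sup>2 \<partial>(mu_op W))"
proof (intro conjI allI)
  let ?V = "mult_op g' \<circ> W \<circ> mult_op g''"
  have V: "linear_op ?V" using assms by (rule linear_op_mult_op)
  note nu = nu_eq_kernel[OF assms]
  fix x a
  have "nu ?V x a = of_real ((cmod (g' x))\<^sup>2) * nu W x a * of_real ((cmod (g'' a))\<^sup>2)"
    by (simp add: nu nu_eq_kernel[OF V] op_kernel_mult_op[OF assms] norm_mult power_mult_distrib)
  thus "(\<Sum>m\<in>UNIV. \<Sum>n\<in>UNIV. omega ?V m n * eta_pow (m * x) * eta_pow (n * a))
      = of_real ((cmod (g' x))\<^sup>2) * nu W x a * of_real ((cmod (g'' a))\<^sup>2)"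
    unfolding nu_def[of ?V] .
  show "nu W x a \<in> \<real>" unfolding nu by (rule Reals_of_real)
  have nonneg: "0 \<le> Re (nu W x a)" for x a by (simp only: nu Re_complex_of_real) simp
  show "0 \<le> Re (nu W x a)" by (rule nonneg)
  have "(mu_norm ?V)\<^sup>2 = (\<Sum>a\<in>UNIV. \<Sum>x\<in>UNIV. (cmod (op_kernel ?V x a))\<^sup>2) / CARD('n)"
    by (simp add: mu_norm_eq[OF V] column_mass_def)
  also have "\<dots> = (\<Sum>x\<in>UNIV. \<Sum>a\<in>UNIV. (cmod (op_kernel ?V x a))\<^sup>2) / CARD('n)"
    by (subst sum.swap) (rule refl)
  also have "\<dots> = (\<Sum>x\<in>UNIV. \<Sum>a\<in>UNIV.
      Re (nu W x a) * ((cmod (g' x))\<^sup>2 * (cmod (g'' a))\<^sup>2)) / (CARD('n))\<^sup>2"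
    by (simp only: nu Re_complex_of_real op_kernel_mult_op[OF assms] norm_mult)
      (simp add: power_mult_distrib power2_eq_square[of "real CARD('n)"] mult.assoc mult_ac
        flip: sum_distrib_left)
  also have "\<dots> = (\<integral>(x, a). (cmod (g' x))\<^sup>2 * (cmod (g'' a))\<^sup>2 \<partial>(mu_op W))"
    by (simp add: integral_mu_op[OF nonneg])
  finally show "(mu_norm ?V)\<^sup>2 = (\<integral>(x, a). (cmod (g' x))\<^sup>2 * (cmod (g'' a))\<^sup>2 \<partial>(mu_op W))" .
qed

end
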